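(* Let $f,g\in\mathcal O_K$. 1. If $f,g\in\mathcal O_K^0$, then $|f+g|_\theta\le\theta\max\{|f|_\theta,|g|_\theta\}$. 2. If $f,g\in\mathcal O_K^1$, then $|f+g|_\theta\le\theta^2\max\{|f|_\theta,|g|_\theta\}$. 3. If $f\in\mathcal O_K^0$ and $g\in\mathcal O_K^1$, then $|f+g|_\theta\le\theta^4\max\{|f|_\theta,|g|_\theta\}$. In particular, $|\cdot|_\theta$ is an infranorm on $\mathcal O_K$ with $\rho=\theta^4$.
   Context: $\theta>1$ is a real quadratic unit with $N(\theta)=1$, so $\theta^2=a\theta-1$ with an integer $a\ge3$ and $\theta'=\theta^{-1}$; $K=\mathbb Q(\theta)\subset\mathbb R$, $\mathcal O_K$ its ring of integers, $\alpha'$ the Galois conjugate. A greedy polynomial is a finite sum $\sum_{i=m}^M b_i\theta^i$ with $b_i\in\{0,\dots,a-1\}$ containing no digit subword $b_ib_{i-1}\cdots b_{i-k}$ ($k\ge1$) of the form $(a-1)(a-2)\cdots(a-2)(a-1)$ (including $(a-1)(a-1)$). Let $\mathcal O_K^0=\{\alpha\in\mathcal O_K:\operatorname{sgn}\alpha=\operatorname{sgn}\alpha'\}\cup\{0\}$, $\mathcal O_K^1=\{\alpha\in\mathcal O_K:\operatorname{sgn}\alpha\ne\operatorname{sgn}\alpha'\}\cup\{0\}$. Each nonzero $\alpha\in\mathcal O_K^0$ is uniquely $\pm$ a greedy polynomial $\sum_{i=m}^Mb_i\theta^i$ with $b_m\ne0$; set $|\alpha|_\theta=\theta^{-m}$,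 $|0|_\theta=0$. With $T=\theta-1$, for $\alpha\in\mathcal O_K^1$ one has $T\alpha\in\mathcal O_K^0$ and $|\alpha|_\theta:=|T\alpha|_\theta$. An infranorm with constant $\rho\ge1$ on an abelian group $G$ is a function $|\cdot|:G\to\mathbb R_{\ge0}$ with $|x|=0\iff x=0$, $|-x|=|x|$, and $|x\pm y|\le\rho\max\{|x|,|y|\}$ for all $x,y$.
   Formalization: The claim is proved for O_K when O_K = Z[θ], and for the order Z[θ] for every a ≥ 3; without this |·|_θ is undefined on part of O_K (e.g. θ = 3+2√2, where 2+√2 in O_K^0 is not ± a greedy polynomial). *)

theory Defs
  imports "HOL-Analysis.Analysis" "HOL-Computational_Algebra.Polynomial"
begin

text \<open>
  Throughout, \<open>\<theta>\<close> is meant to be a real number with \<open>\<theta> > 1\<close> and \<open>\<theta>\<^sup>2 = a * \<theta> - 1\<close> for an integer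
  \<open>a \<ge> 3\<close>.  Since \<open>a\<^sup>2 - 4\<close> is then not a square, \<open>\<theta>\<close> is a quadratic irrational, namely a unit of
  norm 1 whose conjugate is \<open>1 / \<theta>\<close>.
\<close>

definition quadratic_field :: "real \<Rightarrow> real set" where
  "quadratic_field \<theta> = {x + y * \<theta> | x y. x \<in> \<rat> \<and> y \<in> \<rat>}"

definition ring_of_integers :: "real \<Rightarrow> real set" where
  "ring_of_integers \<theta> = {\<alpha> \<in> quadratic_field \<theta>. algebraic_int \<alpha>}"

text \<open>The order \<open>\<int>[\<theta>]\<close>; it contains the negative powers of \<open>\<theta>\<close> because \<open>1 / \<theta> = a - \<theta>\<close>.\<close>

definition int_order :: "real \<Rightarrow> real set" where
  "int_order \<theta> = {x + y * \<theta> | x y. x \<in> \<int> \<and> y \<in> \<int>}"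

text \<open>The nontrivial automorphism of \<open>\<rat>(\<theta>)\<close>; meaningful only on \<^term>\<open>quadratic_field \<theta>\<close>.\<close>

definition galois_conj :: "real \<Rightarrow> real \<Rightarrow> real" where
  "galois_conj \<theta> \<alpha> = (THE \<beta>. \<exists>x\<in>\<rat>. \<exists>y\<in>\<rat>. \<alpha> = x + y * \<theta> \<and> \<beta> = x + y * inverse \<theta>)"

definition same_sign_part :: "real \<Rightarrow> real set \<Rightarrow> real set" where
  "same_sign_part \<theta> R = {\<alpha> \<in> R. sgn \<alpha> = sgn (galois_conj \<theta> \<alpha>)} \<union> {0}"

definition mixed_sign_part :: "real \<Rightarrow> real set \<Rightarrow> real set" where
  "mixed_sign_part \<theta> R = {\<alpha> \<in> R. sgn \<alpha> \<noteq> sgn (galois_conj \<theta> \<alpha>)} \<union> {0}"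

text \<open>
  Only the digits \<open>b i\<close> with \<open>m \<le> i \<le> M\<close> matter.  The second clause excludes the subwords
  \<open>(a-1) (a-2) \<dots> (a-2) (a-1)\<close> occupying the positions \<open>i, i - 1, \<dots>, j\<close> with \<open>j < i\<close>.
\<close>

definition greedy_digits :: "int \<Rightarrow> int \<Rightarrow> int \<Rightarrow> (int \<Rightarrow> int) \<Rightarrow> bool" where
  "greedy_digits a m M b \<longleftrightarrow>
     (\<forall>i\<in>{m..M}. b i \<in> {0..a - 1}) \<and>
     \<not> (\<exists>i j. m \<le> j \<and> j < i \<and> i \<le> M \<and> b i = a - 1 \<and> b j = a - 1 \<and>
          (\<forall>l. j < l \<and> l < i \<longrightarrow> b l = a - 2))"

definition greedy_expansion :: "real \<Rightarrow> int \<Rightarrow> real \<Rightarrow> int \<Rightarrow> bool" where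
  "greedy_expansion \<theta> a \<alpha> m \<longleftrightarrow>
     (\<exists>M b. m \<le> M \<and> greedy_digits a m M b \<and> b m \<noteq> 0 \<and>
            \<alpha> = (\<Sum>i=m..M. of_int (b i) * \<theta> powi i))"

definition greedy_norm :: "real \<Rightarrow> int \<Rightarrow> real \<Rightarrow> real" where
  "greedy_norm \<theta> a \<alpha> =
     (if \<alpha> = 0 then 0
      else \<theta> powi (- (THE m. greedy_expansion \<theta> a \<alpha> m \<or> greedy_expansion \<theta> a (- \<alpha>) m)))"

text \<open>
  Greedy polynomials lie in \<open>\<int>[\<theta>]\<close>, and this order can be strictly smaller than the ring of integers
  (e.g. for \<open>a = 6\<close>).  The following is therefore meaningful only on \<^term>\<open>int_order \<theta>\<close>, hence on all of
  \<^term>\<open>ring_of_integers \<theta>\<close> exactly when the two coincide.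
\<close>

definition theta_norm :: "real \<Rightarrow> int \<Rightarrow> real \<Rightarrow> real" where
  "theta_norm \<theta> a \<alpha> =
     (if \<alpha> = 0 \<or> sgn \<alpha> = sgn (galois_conj \<theta> \<alpha>)
      then greedy_norm \<theta> a \<alpha>
      else greedy_norm \<theta> a ((\<theta> - 1) * \<alpha>))"

definition infranorm_on :: "'a::ab_group_add set \<Rightarrow> real \<Rightarrow> ('a \<Rightarrow> real) \<Rightarrow> bool" where
  "infranorm_on G \<rho> N \<longleftrightarrow>
     0 \<in> G \<and> (\<forall>x\<in>G. - x \<in> G) \<and> (\<forall>x\<in>G. \<forall>y\<in>G. x + y \<in> G) \<and>
     1 \<le> \<rho> \<and>
     (\<forall>x\<in>G. 0 \<le> N x) \<and>
     (\<forall>x\<in>G. N x = 0 \<longleftrightarrow> x = 0) \<and>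
     (\<forall>x\<in>G. N (- x) = N x) \<and>
     (\<forall>x\<in>G. \<forall>y\<in>G. N (x + y) \<le> \<rho> * max (N x) (N y) \<and> N (x - y) \<le> \<rho> * max (N x) (N y))"

end

theory Submission
  imports Defs
begin

text \<open>
  The conjugate of a power \<open>\<theta>\<^sup>i\<close> is \<open>\<theta>\<^sup>-\<^sup>i\<close> and the forbidden subwords are palindromes, so conjugation turns
  a greedy polynomial with lowest exponent \<open>m\<close> into one with highest exponent \<open>-m\<close>.  A greedy
  polynomial with highest exponent \<open>M\<close> lies in \<open>[\<theta>\<^sup>M, \<theta>\<^sup>M\<^sup>+\<^sup>1)\<close>; hence \<open>|\<alpha>|\<^sub>\<theta>\<close> is the largest power of
  \<open>\<theta>\<close> below \<open>|\<alpha>'|\<close> (or below \<open>|T' \<alpha>'|\<close> when the signs differ), and all three inequalities follow from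
  the triangle inequality for \<open>|\<alpha>'|\<close>.  Greedy expansions exist because subtracting the largest
  \<open>\<theta>\<^sup>M \<le> \<alpha>\<close> from a totally positive \<open>\<alpha>\<close> leaves a totally positive number or zero, and the trace
  \<open>\<alpha> + \<alpha>'\<close>, an integer, strictly decreases.
\<close>

section \<open>The unit \<theta>: inverse, size and irrationality\<close>

locale norm_one_unit =
  fixes \<theta> :: real and a :: int
  assumes a_ge: "a \<ge> 3" and theta_gt_1: "\<theta> > 1" and theta_sq: "\<theta>\<^sup>2 = of_int a * \<theta> - 1"
begin

lemma theta_pos [simp]: "\<theta> > 0" and theta_nonneg [simp]: "\<theta> \<ge> 0" and theta_nz [simp]: "\<theta> \<noteq> 0"
  using theta_gt_1 by auto

lemma power_int_theta_pos [simp]: "\<theta> powi k > 0" and power_int_theta_nonneg [simp]: "\<theta> powi k \<ge> 0"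
  by (simp_all add: zero_less_power_int less_imp_le)

lemma inverse_theta: "inverse \<theta> = of_int a - \<theta>"
  using theta_sq by (simp add: field_simps power2_eq_square)

lemma theta_lower: "\<theta> > of_int a - 1" and theta_upper: "\<theta> < of_int a"
proof -
  have "inverse \<theta> < 1" "inverse \<theta> > 0"
    using theta_gt_1 by (auto simp: inverse_less_1_iff)
  then show "\<theta> > of_int a - 1" "\<theta> < of_int a"
    unfolding inverse_theta by simp_all
qed

lemma theta_gt_2: "\<theta> > 2"
  using theta_lower a_ge by linarith

text \<open>A rational \<theta> would be an integer, being a root of a monic integer polynomial; its
  inverse a - \<theta> would then be an integer too, against \<theta> > 1.\<close>

lemma theta_irrational: "\<theta> \<notin> \<rat>"
proof
  assume rat: "\<theta> \<in> \<rat>"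
  have "algebraic_int \<theta>"
  proof (rule algebraic_int.intros[of "[:1, - of_int a, 1:]"])
    show "poly [:1, - of_int a, 1:] \<theta> = 0"
      using theta_sq by (simp add: power2_eq_square algebra_simps)
  qed (auto simp: coeff_pCons split: nat.splits)
  then have "\<theta> \<in> \<int>"
    using rat by (simp add: rational_algebraic_int_is_int)
  then obtain t where t: "\<theta> = of_int t" by (auto elim: Ints_cases)
  have "of_int (t * (a - t)) = (1::real)"
    using theta_sq t by (simp add: power2_eq_square algebra_simps)
  then have "t * (a - t) = 1" by linarith
  then have "t = 1 \<or> t = -1" by (auto simp: zmult_eq_1_iff)
  then show False using theta_gt_1 t by auto
qed

lemma rat_coeffs_unique:
  assumes "x \<in> \<rat>" "y \<in> \<rat>" "u \<in> \<rat>" "v \<in> \<rat>" "x + y * \<theta> = u + v * \<theta>"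
  shows "x = u \<and> y = v"
proof (cases "y = v")
  case False
  then have "\<theta> = (u - x) / (y - v)"
    using assms(5) by (simp add: field_simps)
  then show ?thesis using assms(1-4) theta_irrational by (auto intro: Rats_divide Rats_diff)
qed (use assms(5) in auto)

section \<open>Conjugate pairs in the order \<int>[\<theta>]\<close>

text \<open>Replaces the \<open>THE\<close> of \<open>galois_conj\<close> by a relation, so that
  ring operations and sums can be carried out on both coordinates at once;
  \<open>galois_conj_eq\<close> leads back to the function.\<close>

definition conj_pair :: "real \<Rightarrow> real \<Rightarrow> bool" where
  "conj_pair \<alpha> \<beta> \<longleftrightarrow> (\<exists>x y :: int. \<alpha> = of_int x + of_int y * \<theta> \<and> \<beta> = of_int x + of_int y * inverse \<theta>)"

lemma conj_pairI:
  "\<alpha> = of_int x + of_int y * \<theta> \<Longrightarrow> \<beta> = of_int x + of_int y * inverse \<theta> \<Longrightarrow> conj_pair \<alpha> \<beta>"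
  unfolding conj_pair_def by blast

lemma galois_conj_eq:
  assumes "conj_pair \<alpha> \<beta>"
  shows "galois_conj \<theta> \<alpha> = \<beta>"
proof -
  obtain x y :: int where xy: "\<alpha> = of_int x + of_int y * \<theta>" "\<beta> = of_int x + of_int y * inverse \<theta>"
    using assms unfolding conj_pair_def by blast
  have rat: "of_int x \<in> (\<rat> :: real set)" "of_int y \<in> (\<rat> :: real set)" by auto
  show ?thesis
    unfolding galois_conj_def
  proof (rule the_equality)
    show "\<exists>x\<in>\<rat>. \<exists>y\<in>\<rat>. \<alpha> = x + y * \<theta> \<and> \<beta> = x + y * inverse \<theta>"
      using xy rat by blast
  next
    fix \<gamma>
    assume "\<exists>x\<in>\<rat>. \<exists>y\<in>\<rat>. \<alpha> = x + y * \<theta> \<and> \<gamma> = x + y * inverse \<theta>"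
    then show "\<gamma> = \<beta>" using rat_coeffs_unique rat xy by metis
  qed
qed

lemma conj_pair_galois: "\<alpha> \<in> int_order \<theta> \<Longrightarrow> conj_pair \<alpha> (galois_conj \<theta> \<alpha>)"
proof -
  assume "\<alpha> \<in> int_order \<theta>"
  then obtain x y :: int where "\<alpha> = of_int x + of_int y * \<theta>"
    unfolding int_order_def by (auto elim!: Ints_cases)
  then have "conj_pair \<alpha> (of_int x + of_int y * inverse \<theta>)" by (auto intro: conj_pairI)
  then show ?thesis using galois_conj_eq by simp
qed

lemma conj_pair_zero_left: "conj_pair 0 \<beta> \<Longrightarrow> \<beta> = 0"
proof -
  assume p: "conj_pair 0 \<beta>"
  have "conj_pair 0 0" by (rule conj_pairI[of _ 0 0]) auto
  then show ?thesis using galois_conj_eq p by metis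
qed

lemma conj_pair_sym: "conj_pair \<alpha> \<beta> \<Longrightarrow> conj_pair \<beta> \<alpha>"
proof -
  assume "conj_pair \<alpha> \<beta>"
  then obtain x y :: int where xy: "\<alpha> = of_int x + of_int y * \<theta>" "\<beta> = of_int x + of_int y * inverse \<theta>"
    unfolding conj_pair_def by blast
  show ?thesis
    \<comment> \<open>Substituting a - \<theta> for \<open>inverse \<theta>\<close> in
      \<open>\<beta>\<close> gives these coefficients.\<close>
    by (rule conj_pairI[of _ "x + a * y" "- y"])
       (use xy in \<open>auto simp: inverse_theta algebra_simps\<close>)
qed

lemma conj_pair_zero_iff: "conj_pair \<alpha> \<beta> \<Longrightarrow> \<alpha> = 0 \<longleftrightarrow> \<beta> = 0"
  using conj_pair_zero_left conj_pair_sym by blast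

lemma conj_pair_of_int: "conj_pair (of_int n) (of_int n)"
  by (rule conj_pairI[of _ n 0]) auto

lemma conj_pair_0: "conj_pair 0 0" and conj_pair_1: "conj_pair 1 1"
  using conj_pair_of_int[of 0] conj_pair_of_int[of 1] by simp_all

lemma conj_pair_theta: "conj_pair \<theta> (inverse \<theta>)"
  by (rule conj_pairI[of _ 0 1]) auto

lemma conj_pair_add:
  assumes "conj_pair \<alpha> \<beta>" "conj_pair \<gamma> \<delta>"
  shows "conj_pair (\<alpha> + \<gamma>) (\<beta> + \<delta>)"
proof -
  obtain x y u v :: int where xy: "\<alpha> = of_int x + of_int y * \<theta>" "\<beta> = of_int x + of_int y * inverse \<theta>"
    "\<gamma> = of_int u + of_int v * \<theta>" "\<delta> = of_int u + of_int v * inverse \<theta>"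
    using assms unfolding conj_pair_def by blast
  show ?thesis
    by (rule conj_pairI[of _ "x + u" "y + v"]) (use xy in \<open>auto simp: algebra_simps\<close>)
qed

text \<open>Both \<theta> and its inverse are roots of \<open>t\<^sup>2 = a * t - 1\<close>, so one
  reduction of the product, done for an arbitrary root t, yields the same integer coefficients in
  both coordinates.\<close>

lemma conj_pair_mult:
  assumes "conj_pair \<alpha> \<beta>" "conj_pair \<gamma> \<delta>"
  shows "conj_pair (\<alpha> * \<gamma>) (\<beta> * \<delta>)"
proof -
  obtain x y u v :: int where xy: "\<alpha> = of_int x + of_int y * \<theta>" "\<beta> = of_int x + of_int y * inverse \<theta>"
    "\<gamma> = of_int u + of_int v * \<theta>" "\<delta> = of_int u + of_int v * inverse \<theta>"
    using assms unfolding conj_pair_def by blast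
  have inv: "(inverse \<theta>)\<^sup>2 = of_int a * inverse \<theta> - 1"
    using theta_sq unfolding inverse_theta by (simp add: power2_eq_square algebra_simps)
  have *: "(of_int x + of_int y * t) * (of_int u + of_int v * t)
        = of_int (x * u - y * v) + of_int (x * v + y * u + a * y * v) * t"
    if "t\<^sup>2 = of_int a * t - 1" for t :: real
  proof -
    have "(of_int x + of_int y * t) * (of_int u + of_int v * t)
       = of_int x * of_int u + (of_int x * of_int v + of_int y * of_int u) * t + of_int y * of_int v * t\<^sup>2"
      by (simp add: power2_eq_square algebra_simps)
    then show ?thesis unfolding that by (simp add: algebra_simps)
  qed
  show ?thesis
    by (rule conj_pairI[of _ "x * u - y * v" "x * v + y * u + a * y * v"])
       (use xy * theta_sq inv in auto)
qed

lemma conj_pair_minus: "conj_pair \<alpha> \<beta> \<Longrightarrow> conj_pair (- \<alpha>) (- \<beta>)"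
  using conj_pair_mult[OF conj_pair_of_int[of "-1"]] by fastforce

lemma conj_pair_diff: "conj_pair \<alpha> \<beta> \<Longrightarrow> conj_pair \<gamma> \<delta> \<Longrightarrow> conj_pair (\<alpha> - \<gamma>) (\<beta> - \<delta>)"
  using conj_pair_add conj_pair_minus by fastforce

lemma conj_pair_power: "conj_pair \<alpha> \<beta> \<Longrightarrow> conj_pair (\<alpha> ^ n) (\<beta> ^ n)"
  by (induction n) (auto intro: conj_pair_mult conj_pair_1)

lemma conj_pair_power_int: "conj_pair (\<theta> powi i) (\<theta> powi (- i))"
  using conj_pair_power[OF conj_pair_theta] conj_pair_power[OF conj_pair_sym[OF conj_pair_theta]]
  by (auto simp: power_int_def conj_pair_1)

lemma conj_pair_sum: "(\<And>i. i \<in> A \<Longrightarrow> conj_pair (f i) (g i)) \<Longrightarrow> conj_pair (sum f A) (sum g A)"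
  by (induction A rule: infinite_finite_induct) (auto intro: conj_pair_add conj_pair_0)

text \<open>Integrality of the trace makes the descent in \<open>finite_greedy_exists\<close>
  terminate.\<close>

lemma trace_Ints: "conj_pair \<alpha> \<beta> \<Longrightarrow> \<alpha> + \<beta> \<in> \<int>"
proof -
  assume "conj_pair \<alpha> \<beta>"
  then obtain x y :: int where "\<alpha> = of_int x + of_int y * \<theta>" "\<beta> = of_int x + of_int y * inverse \<theta>"
    unfolding conj_pair_def by blast
  then have "\<alpha> + \<beta> = of_int (2 * x + a * y)" by (simp add: inverse_theta algebra_simps)
  then show ?thesis by (metis Ints_of_int)
qed

section \<open>Size of the conjugate of a greedy polynomial\<close>

text \<open>
  The induction on the lowest digit needs a second, smaller bound for the digit words that remain
  greedy when a digit \<open>a - 1\<close> is put below them.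
\<close>

lemma greedy_conj_upper:
  assumes "greedy_digits a m M b"
  shows "(\<Sum>i=m..M. of_int (b i) * \<theta> powi (- i)) < \<theta> powi (1 - m)"
proof -
  let ?S = "\<lambda>m. \<Sum>i=m..M. of_int (b i) * \<theta> powi (- i)"
  \<comment> \<open>Read upwards from m, the word begins with a possibly empty run of a-2 followed
    by a-1: exactly the case in which a digit a-1 at position m-1 would create a forbidden
    subword.\<close>
  let ?heavy = "\<lambda>m. \<exists>i\<in>{m..M}. b i = a - 1 \<and> (\<forall>l\<in>{m..<i}. b l = a - 2)"
  have "?S m < \<theta> powi (1 - m) \<and> (\<not> ?heavy m \<longrightarrow> ?S m < \<theta> powi (- m) * (\<theta> - 1))"
    using assms
  proof (induction "nat (M + 1 - m)" arbitrary: m)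
    case 0
    then have "{m..M} = {}" by auto
    then show ?case using theta_gt_1 by simp
  next
    case (Suc n)
    then have mM: "m \<le> M" by linarith
    have "greedy_digits a (m + 1) M b"
      using Suc.prems unfolding greedy_digits_def by force
    with Suc.hyps have IH: "?S (m + 1) < \<theta> powi (- m)"
      "\<not> ?heavy (m + 1) \<Longrightarrow> ?S (m + 1) < \<theta> powi (- (m + 1)) * (\<theta> - 1)"
      by force+
    define P where "P = \<theta> powi (- m)"
    have P: "P > 0" unfolding P_def by simp
    have powers: "\<theta> powi (1 - m) = P * \<theta>" "\<theta> powi (- (m + 1)) = P * inverse \<theta>"
      unfolding P_def by (simp_all add: power_int_diff power_int_minus power_int_add divide_inverse mult.commute)
    have S: "?S m = of_int (b m) * P + ?S (m + 1)"
    proof -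
      have "{m..M} = insert m {m + 1..M}" using mM by auto
      then show ?thesis by (simp add: P_def)
    qed
    \<comment> \<open>Crude estimate: all digits above m together contribute less than one
      P.\<close>
    have small: "?S m < P * of_int (k + 1)" if "b m \<le> k" for k
    proof -
      have "of_int (b m) * P \<le> of_int k * P" using that P by simp
      moreover have "P * of_int (k + 1) = of_int k * P + P" by (simp add: algebra_simps)
      ultimately show ?thesis using S IH(1)[folded P_def] by linarith
    qed
    have light: "?S m < of_int (b m) * P + P * (1 - inverse \<theta>)" if "\<not> ?heavy (m + 1)"
      using S IH(2)[OF that] powers(2) by (simp add: algebra_simps)
    have bm: "b m \<le> a - 1" using Suc.prems mM unfolding greedy_digits_def by auto
    have below: "P * of_int (a - 1) < P * \<theta>" using theta_lower P by simp
    have "?S m < P * \<theta>"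
    proof (cases "b m = a - 1")
      case True
      have "\<not> ?heavy (m + 1)"
      proof
        assume "?heavy (m + 1)"
        then obtain i where "i \<in> {m + 1..M}" "b i = a - 1" "\<forall>l\<in>{m + 1..<i}. b l = a - 2" by blast
        then have "m \<le> m \<and> m < i \<and> i \<le> M \<and> b i = a - 1 \<and> b m = a - 1 \<and>
            (\<forall>l. m < l \<and> l < i \<longrightarrow> b l = a - 2)" using True by auto
        then show False using Suc.prems unfolding greedy_digits_def by blast
      qed
      \<comment> \<open>The bound (a - 1) * P + P * (1 - inverse \<theta>) equals P * \<theta>
        because a - inverse \<theta> = \<theta>; this is what dictates the factor \<theta> - 1 in
        the second claim.\<close>
      from light[OF this] show ?thesis
        using True by (simp add: inverse_theta algebra_simps)
    next
      case False
      then show ?thesis using small[of "a - 2"] bm below by simp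
    qed
    moreover have "?S m < P * (\<theta> - 1)" if nh: "\<not> ?heavy m"
    proof -
      have "b m \<noteq> a - 1" using nh mM by force
      show ?thesis
      proof (cases "b m = a - 2")
        case True
        \<comment> \<open>Putting a digit a-2 below a heavy word keeps it heavy.\<close>
        have "\<not> ?heavy (m + 1)"
        proof
          assume "?heavy (m + 1)"
          then obtain i where i: "i \<in> {m + 1..M}" "b i = a - 1" "\<forall>l\<in>{m + 1..<i}. b l = a - 2" by blast
          have "b l = a - 2" if "l \<in> {m..<i}" for l
            using i(3) True that by (cases "l = m") auto
          then show False using nh i by auto
        qed
        from light[OF this] show ?thesis
          using True by (simp add: inverse_theta algebra_simps)
      next
        case False
        then have "b m \<le> a - 3" using bm \<open>b m \<noteq> a - 1\<close> by linarith
        from small[OF this] show ?thesis using below by (simp add: algebra_simps)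
      qed
    qed
    ultimately show ?case unfolding powers(1) P_def by blast
  qed
  then show ?thesis by blast
qed

text \<open>All terms are nonnegative, so the lowest one alone bounds \<alpha> and its conjugate
  from below. With \<open>greedy_conj_upper\<close> this confines the conjugate to an interval
  between consecutive powers, which determines m.\<close>

lemma greedy_expansion_conj:
  assumes "greedy_expansion \<theta> a \<alpha> m"
  obtains \<beta> where "conj_pair \<alpha> \<beta>" "\<alpha> > 0" "\<theta> powi (- m) \<le> \<beta>" "\<beta> < \<theta> powi (1 - m)"
proof -
  obtain M b where b: "m \<le> M" "greedy_digits a m M b" "b m \<noteq> 0"
    and \<alpha>: "\<alpha> = (\<Sum>i=m..M. of_int (b i) * \<theta> powi i)"
    using assms unfolding greedy_expansion_def by blast
  define \<beta> where "\<beta> = (\<Sum>i=m..M. of_int (b i) * \<theta> powi (- i))"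
  have pair: "conj_pair \<alpha> \<beta>"
    unfolding \<alpha> \<beta>_def by (intro conj_pair_sum conj_pair_mult conj_pair_of_int conj_pair_power_int)
  have nonneg: "b i \<ge> 0" if "i \<in> {m..M}" for i
    using b(2) that unfolding greedy_digits_def by auto
  then have bm: "b m \<ge> 1" using b(1,3) by force
  have single_le: "of_int (b m) * \<theta> powi e m \<le> (\<Sum>i=m..M. of_int (b i) * \<theta> powi e i)" for e :: "int \<Rightarrow> int"
    using b(1) nonneg by (intro member_le_sum) auto
  have first: "\<theta> powi k \<le> of_int (b m) * \<theta> powi k" for k
    using bm by simp
  have "\<theta> powi m \<le> \<alpha>"
    using first[of m] single_le[of "\<lambda>i. i"] unfolding \<alpha> by linarith
  moreover have "\<theta> powi m > 0" by simp
  ultimately have "\<alpha> > 0" by linarith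
  moreover have "\<theta> powi (- m) \<le> \<beta>"
    using first[of "- m"] single_le[of "\<lambda>i. - i"] unfolding \<beta>_def by linarith
  moreover have "\<beta> < \<theta> powi (1 - m)"
    unfolding \<beta>_def by (rule greedy_conj_upper[OF b(2)])
  ultimately show ?thesis using that pair by blast
qed

section \<open>Rounding down to powers of \<theta>\<close>

definition pfloor :: "real \<Rightarrow> int" where
  "pfloor x = \<lfloor>log \<theta> x\<rfloor>"

lemma pfloor_eq_iff:
  assumes "x > 0"
  shows "pfloor x = k \<longleftrightarrow> \<theta> powi k \<le> x \<and> x < \<theta> powi (k + 1)"
proof -
  have powr: "\<theta> powr of_int k = \<theta> powi k" for k
    by (rule powr_real_of_int') auto
  have "\<theta> powr (of_int k + 1) = \<theta> powi (k + 1)" using powr[of "k + 1"] by simp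
  then show ?thesis
    using assms theta_gt_1 powr[of k] by (simp add: pfloor_def floor_log_eq_powr_iff)
qed

lemma pfloor_unique:
  assumes "\<theta> powi k \<le> x" "x < \<theta> powi (k + 1)"
  shows "pfloor x = k"
  using pfloor_eq_iff[of x k] assms power_int_theta_pos[of k] by linarith

lemma
  assumes "x > 0"
  shows pfloor_lower: "\<theta> powi (pfloor x) \<le> x" and pfloor_upper: "x < \<theta> powi (pfloor x + 1)"
  using pfloor_eq_iff[OF assms, of "pfloor x"] by blast+

text \<open>Consecutive powers of \<theta> bound disjoint intervals, so all greedy expansions of
  \<alpha> share one lowest exponent, read off from the conjugate.\<close>

lemma greedy_expansion_pfloor:
  assumes "conj_pair \<alpha> \<beta>" "greedy_expansion \<theta> a \<alpha> m"
  shows "m = - pfloor \<beta>" "\<alpha> > 0"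
proof -
  obtain \<gamma> where g: "conj_pair \<alpha> \<gamma>" "\<alpha> > 0" "\<theta> powi (- m) \<le> \<gamma>" "\<gamma> < \<theta> powi (1 - m)"
    by (rule greedy_expansion_conj[OF assms(2)])
  have "\<gamma> = \<beta>" using galois_conj_eq[OF g(1)] galois_conj_eq[OF assms(1)] by simp
  then show "m = - pfloor \<beta>" "\<alpha> > 0"
    using g pfloor_unique[of "- m" \<beta>] by simp_all
qed

section \<open>Existence of greedy expansions\<close>

text \<open>Multiplying by a power of \<open>\<theta>\<close> reduces to \<open>1 \<le> \<alpha> < \<theta>\<close>, where \<open>\<alpha> = x + y\<theta>\<close> forces \<open>y \<le> 0\<close>.\<close>

lemma conj_ge_power:
  assumes pair: "conj_pair \<alpha> \<beta>" and pos: "\<beta> > 0" and lo: "\<theta> powi M \<le> \<alpha>" and up: "\<alpha> < \<theta> powi (M + 1)"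
  shows "\<theta> powi (- M) \<le> \<beta>"
proof -
  define \<gamma> \<delta> where "\<gamma> = \<alpha> * \<theta> powi (- M)" and "\<delta> = \<beta> * \<theta> powi M"
  have "conj_pair \<gamma> \<delta>"
    unfolding \<gamma>_def \<delta>_def using conj_pair_mult[OF pair conj_pair_power_int[of "- M"]] by simp
  then obtain x y :: int where x: "\<gamma> = of_int x + of_int y * \<theta>" "\<delta> = of_int x + of_int y * inverse \<theta>"
    unfolding conj_pair_def by blast
  have g1: "\<gamma> \<ge> 1" and g2: "\<gamma> < \<theta>"
    using lo up unfolding \<gamma>_def
    by (simp_all add: power_int_minus power_int_add field_simps)
  have d: "\<delta> > 0" unfolding \<delta>_def using pos by simp
  \<comment> \<open>Suppose y \<ge> 1. If x \<ge> 0, then \<gamma> \<ge> \<theta>. If x = -k < 0,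
    then \<delta> > 0 forces y > k * \<theta>, hence \<gamma> > k * (\<theta> * \<theta> - 1) >
    \<theta>. Both contradict \<gamma> < \<theta>.\<close>
  have "y \<le> 0"
  proof (rule ccontr)
    assume "\<not> y \<le> 0"
    then have y: "y \<ge> 1" by simp
    then have yt: "of_int y * \<theta> \<ge> \<theta>" by simp
    show False
    proof (cases "x \<ge> 0")
      case True
      then show False using g2 x(1) yt by simp
    next
      case False
      define k :: real where "k = - of_int x"
      have k: "k \<ge> 1" using False unfolding k_def by linarith
      have yk: "of_int y > k * \<theta>"
        using d unfolding x(2) k_def by (simp add: field_simps)
      have "of_int y * \<theta> > k * \<theta> * \<theta>"
        by (rule mult_strict_right_mono[OF yk]) simp
      then have "\<gamma> > k * (\<theta> * \<theta> - 1)"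
        unfolding x(1) k_def by (simp add: algebra_simps)
      moreover have big: "\<theta> * \<theta> - 1 > \<theta>"
        using theta_gt_2 mult_strict_right_mono[of 2 \<theta> \<theta>] by linarith
      have "k * (\<theta> * \<theta> - 1) \<ge> 1 * (\<theta> * \<theta> - 1)"
        using big theta_gt_2 by (intro mult_right_mono[OF k]) linarith
      ultimately show False using g2 big by simp
    qed
  qed
  moreover have "inverse \<theta> \<le> \<theta>" using theta_lower a_ge by (simp add: inverse_theta)
  \<comment> \<open>Since y \<le> 0, replacing \<theta> by its smaller inverse cannot decrease the
    value, so \<delta> \<ge> \<gamma> \<ge> 1.\<close>
  ultimately have "of_int y * inverse \<theta> \<ge> of_int y * \<theta>"
    by (intro mult_left_mono_neg) auto
  then have "\<delta> \<ge> 1" using x g1 by linarith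
  then show ?thesis unfolding \<delta>_def by (simp add: power_int_minus field_simps)
qed

text \<open>Digits are indexed by all integers, with finite support, so that raising one digit in
  the induction needs no adjustment of endpoints; \<open>greedy_expansion_exists\<close> restores
  them.\<close>

definition finite_greedy :: "(int \<Rightarrow> int) \<Rightarrow> bool" where
  "finite_greedy b \<longleftrightarrow> finite {i. b i \<noteq> 0} \<and> (\<forall>i. b i \<in> {0..a - 1}) \<and>
     \<not> (\<exists>i j. j < i \<and> b i = a - 1 \<and> b j = a - 1 \<and> (\<forall>l. j < l \<and> l < i \<longrightarrow> b l = a - 2))"

definition digit_value :: "(int \<Rightarrow> int) \<Rightarrow> real" where
  "digit_value b = (\<Sum>i | b i \<noteq> 0. of_int (b i) * \<theta> powi i)"

lemma digit_value_superset:
  "finite A \<Longrightarrow> {i. b i \<noteq> 0} \<subseteq> A \<Longrightarrow> digit_value b = (\<Sum>i\<in>A. of_int (b i) * \<theta> powi i)"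
  unfolding digit_value_def by (rule sum.mono_neutral_left) auto

lemma digit_value_ge_sum:
  assumes "finite {i. b i \<noteq> 0}" "\<And>i. b i \<ge> 0" "finite B"
  shows "(\<Sum>i\<in>B. of_int (b i) * \<theta> powi i) \<le> digit_value b"
proof -
  have "digit_value b = (\<Sum>i\<in>B \<union> {i. b i \<noteq> 0}. of_int (b i) * \<theta> powi i)"
    using assms by (intro digit_value_superset) auto
  moreover have "(\<Sum>i\<in>B. of_int (b i) * \<theta> powi i) \<le> \<dots>"
    using assms by (intro sum_mono2 mult_nonneg_nonneg) auto
  ultimately show ?thesis by simp
qed

text \<open>The relation a * \<theta>^k = \<theta>^(k+1) + \<theta>^(k-1) makes the sum telescope. A
  forbidden word with top position i is thus worth more than \<theta>^(i+1), so it cannot arise when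
  the leading power was chosen as large as possible.\<close>

lemma forbidden_word_value:
  assumes "j < i" "b i = a - 1" "b j = a - 1" "\<And>l. j < l \<Longrightarrow> l < i \<Longrightarrow> b l = a - 2"
  shows "(\<Sum>l=j..i. of_int (b l) * \<theta> powi l) = \<theta> powi (i + 1) + \<theta> powi (j - 1)"
proof -
  have three: "of_int a * \<theta> powi k = \<theta> powi (k + 1) + \<theta> powi (k - 1)" for k
  proof -
    have "of_int a = \<theta> + inverse \<theta>" by (simp add: inverse_theta)
    then show ?thesis
      by (simp add: power_int_add power_int_diff divide_inverse distrib_left distrib_right mult.commute)
  qed
  have tail: "(\<Sum>l=j..k. of_int (b l) * \<theta> powi l) = \<theta> powi (k + 1) - \<theta> powi k + \<theta> powi (j - 1)"
    if "j \<le> k" "k < i" for k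
    using that
  proof (induction k rule: int_ge_induct)
    case base
    then show ?case using assms(3) three[of j] by (simp add: left_diff_distrib)
  next
    case (step k)
    have "{j..k + 1} = insert (k + 1) {j..k}" using step by auto
    then show ?case using step assms(4)[of "k + 1"] three[of "k + 1"]
      by (simp add: left_diff_distrib add.commute)
  qed
  have "{j..i} = insert i {j..i - 1}" using assms(1) by auto
  then show ?thesis using tail[of "i - 1"] assms(1,2) three[of i]
    by (simp add: left_diff_distrib)
qed

text \<open>Induction on the trace. The remainder after removing \<theta>^M has a greedy expansion
  c; adding 1 to its digit at M must be shown to preserve greediness, and \<alpha> < \<theta>^(M+1)
  rules out every violation.\<close>

lemma finite_greedy_exists:
  assumes "conj_pair \<alpha> \<beta>" "\<alpha> > 0" "\<beta> > 0"
  shows "\<exists>b. finite_greedy b \<and> digit_value b = \<alpha>"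
  using assms
proof (induction "nat \<lfloor>\<alpha> + \<beta>\<rfloor>" arbitrary: \<alpha> \<beta> rule: less_induct)
  case less
  define M where "M = pfloor \<alpha>"
  have M: "\<theta> powi M \<le> \<alpha>" "\<alpha> < \<theta> powi (M + 1)"
    unfolding M_def using less.prems pfloor_lower pfloor_upper by blast+
  have Mc: "\<theta> powi (- M) \<le> \<beta>"
    by (rule conj_ge_power[OF less.prems(1,3) M])
  define \<alpha>1 \<beta>1 where "\<alpha>1 = \<alpha> - \<theta> powi M" and "\<beta>1 = \<beta> - \<theta> powi (- M)"
  have pair: "conj_pair \<alpha>1 \<beta>1"
    unfolding \<alpha>1_def \<beta>1_def by (intro conj_pair_diff less.prems conj_pair_power_int)
  have "\<exists>c. finite_greedy c \<and> digit_value c = \<alpha>1"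
  proof (cases "\<alpha>1 = 0")
    case True
    then show ?thesis
      using a_ge by (intro exI[of _ "\<lambda>_. 0"]) (auto simp: finite_greedy_def digit_value_def)
  next
    case False
    then have pos: "\<alpha>1 > 0" "\<beta>1 > 0"
      using conj_pair_zero_iff[OF pair] M(1) Mc unfolding \<alpha>1_def \<beta>1_def by auto
    have "\<alpha>1 + \<beta>1 < \<alpha> + \<beta>"
      unfolding \<alpha>1_def \<beta>1_def
      using power_int_theta_pos[of M] power_int_theta_pos[of "- M"] by linarith
    \<comment> \<open>Both traces are positive integers, so the floors are exact and the strict
      decrease survives them.\<close>
    then have "nat \<lfloor>\<alpha>1 + \<beta>1\<rfloor> < nat \<lfloor>\<alpha> + \<beta>\<rfloor>"
      using trace_Ints[OF pair] trace_Ints[OF less.prems(1)] pos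
      by (auto elim!: Ints_cases)
    then show ?thesis using less.hyps pair pos by blast
  qed
  then obtain c where c: "finite_greedy c" "digit_value c = \<alpha>1" by blast
  have fin: "finite {i. c i \<noteq> 0}" and dig: "\<And>i. 0 \<le> c i" "\<And>i. c i \<le> a - 1"
    using c(1) unfolding finite_greedy_def by auto
  have high: "c i = 0" if "i > M" for i
  proof (rule ccontr)
    assume "c i \<noteq> 0"
    then have "c i \<ge> 1" using dig(1)[of i] by linarith
    then have "\<theta> powi i \<le> of_int (c i) * \<theta> powi i" by simp
    also have "\<dots> \<le> \<alpha>1" using digit_value_ge_sum[OF fin dig(1), of "{i}"] c(2) by simp
    also have "\<dots> < \<theta> powi (M + 1)" using M(2) power_int_theta_pos[of M] unfolding \<alpha>1_def by linarith
    also have "\<dots> \<le> \<theta> powi i" using that theta_gt_1 by (intro power_int_increasing) auto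
    finally show False by simp
  qed
  define b where "b = c(M := c M + 1)"
  have finb: "finite {i. b i \<noteq> 0}"
    by (rule finite_subset[of _ "insert M {i. c i \<noteq> 0}"]) (auto simp: b_def fin)
  have digb: "b i \<ge> 0" for i using dig unfolding b_def by (auto intro: add_nonneg_nonneg)
  have val: "digit_value b = \<alpha>"
  proof -
    let ?A = "insert M {i. c i \<noteq> 0}"
    have "digit_value b = (\<Sum>i\<in>?A. of_int (b i) * \<theta> powi i)"
      by (rule digit_value_superset) (auto simp: b_def fin)
    also have "\<dots> = (\<Sum>i\<in>?A. of_int (c i) * \<theta> powi i + (if i = M then \<theta> powi M else 0))"
      by (rule sum.cong) (auto simp: b_def algebra_simps)
    also have "\<dots> = digit_value c + \<theta> powi M"
      using fin digit_value_superset[of ?A c] by (simp add: sum.distrib subset_insertI)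
    finally show ?thesis using c(2) unfolding \<alpha>1_def by simp
  qed
  \<comment> \<open>A digit at least a would give \<alpha> \<ge> a * \<theta>^M >
    \<theta>^(M+1).\<close>
  have bM: "b M \<le> a - 1"
  proof (rule ccontr)
    assume "\<not> b M \<le> a - 1"
    then have "of_int a \<le> (of_int (b M) :: real)" by simp
    then have "of_int a * \<theta> powi M \<le> of_int (b M) * \<theta> powi M" by simp
    also have "\<dots> \<le> \<alpha>" using digit_value_ge_sum[OF finb digb, of "{M}"] val by simp
    finally have "of_int a * \<theta> powi M < \<theta> powi (M + 1)" using M(2) by linarith
    then have "of_int a < \<theta>" by (simp add: power_int_add)
    then show False using theta_upper by linarith
  qed
  have "\<not> (j < i \<and> b i = a - 1 \<and> b j = a - 1 \<and> (\<forall>l. j < l \<and> l < i \<longrightarrow> b l = a - 2))" for i j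
  proof
    assume w: "j < i \<and> b i = a - 1 \<and> b j = a - 1 \<and> (\<forall>l. j < l \<and> l < i \<longrightarrow> b l = a - 2)"
    \<comment> \<open>A forbidden word with top below M already occurs in c, one with top at M is
      too large by \<open>forbidden_word_value\<close>, and above M all digits vanish.\<close>
    consider "i < M" | "i = M" | "i > M" by linarith
    then show False
    proof cases
      case 1
      then have "j < i \<and> c i = a - 1 \<and> c j = a - 1 \<and> (\<forall>l. j < l \<and> l < i \<longrightarrow> c l = a - 2)"
        using w unfolding b_def by auto
      then show False using c(1) unfolding finite_greedy_def by blast
    next
      case 2
      have "\<theta> powi (M + 1) + \<theta> powi (j - 1) \<le> digit_value b"
        using forbidden_word_value[of j i b] w 2 digit_value_ge_sum[OF finb digb, of "{j..i}"] by auto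
      moreover have "\<theta> powi (j - 1) > 0" by simp
      ultimately show False using val M(2) by linarith
    next
      case 3
      then show False using w high[of i] a_ge unfolding b_def by auto
    qed
  qed
  moreover have "b i \<in> {0..a - 1}" for i
    using digb[of i] bM dig(2)[of i] unfolding b_def by (cases "i = M") auto
  ultimately have "finite_greedy b" using finb unfolding finite_greedy_def by blast
  then show ?case using val by blast
qed

text \<open>Cutting the digit function down to the range between the extremes of its support makes
  the lowest digit nonzero.\<close>

lemma greedy_expansion_exists:
  assumes "conj_pair \<alpha> \<beta>" "\<alpha> > 0" "\<beta> > 0"
  shows "\<exists>m. greedy_expansion \<theta> a \<alpha> m"
proof -
  obtain b where b: "finite_greedy b" "digit_value b = \<alpha>"
    using finite_greedy_exists[OF assms] by blast
  let ?S = "{i. b i \<noteq> 0}"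
  have fin: "finite ?S" using b(1) unfolding finite_greedy_def by blast
  have ne: "?S \<noteq> {}" using b(2) assms(2) unfolding digit_value_def by (metis less_irrefl sum.empty)
  have mem: "Min ?S \<in> ?S" using Min_in[OF fin ne] .
  have sub: "?S \<subseteq> {Min ?S..Max ?S}" using Min_le[OF fin] Max_ge[OF fin] by (intro subsetI) simp
  have "Min ?S \<le> Max ?S" using Max_ge[OF fin mem] .
  moreover have "greedy_digits a (Min ?S) (Max ?S) b"
    using b(1) unfolding finite_greedy_def greedy_digits_def by blast
  moreover have "\<alpha> = (\<Sum>i=Min ?S..Max ?S. of_int (b i) * \<theta> powi i)"
    using b(2) digit_value_superset[OF _ sub] by simp
  ultimately show ?thesis using mem unfolding greedy_expansion_def by blast
qed

section \<open>The norm as a rounded conjugate\<close>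

text \<open>Equal signs mean that \<alpha> or -\<alpha> is totally positive, hence has an expansion.
  Any expansion of either has lowest exponent \<open>- pfloor \<bar>\<beta>\<bar>\<close>, so the
  \<open>THE\<close> is well defined.\<close>

lemma greedy_norm_eq:
  assumes "conj_pair \<alpha> \<beta>" "\<alpha> * \<beta> > 0"
  shows "greedy_norm \<theta> a \<alpha> = \<theta> powi (pfloor \<bar>\<beta>\<bar>)"
proof -
  have pair': "conj_pair (- \<alpha>) (- \<beta>)" using assms(1) by (rule conj_pair_minus)
  have sgn: "\<alpha> > 0 \<longleftrightarrow> \<beta> > 0" and nz: "\<alpha> \<noteq> 0"
    using assms(2) by (auto simp: zero_less_mult_iff)
  have "m = - pfloor \<bar>\<beta>\<bar>" if "greedy_expansion \<theta> a \<alpha> m" for m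
    using greedy_expansion_pfloor[OF assms(1) that] sgn by simp
  moreover have "m = - pfloor \<bar>\<beta>\<bar>" if "greedy_expansion \<theta> a (- \<alpha>) m" for m
    using greedy_expansion_pfloor[OF pair' that] sgn by simp
  moreover have "\<exists>m. greedy_expansion \<theta> a \<alpha> m \<or> greedy_expansion \<theta> a (- \<alpha>) m"
  proof (cases "\<alpha> > 0")
    case True
    then show ?thesis using greedy_expansion_exists[OF assms(1)] sgn by blast
  next
    case False
    then have "- \<alpha> > 0" "- \<beta> > 0" using assms(2) by (auto simp: zero_less_mult_iff)
    then show ?thesis using greedy_expansion_exists[OF pair'] by blast
  qed
  ultimately have "(THE m. greedy_expansion \<theta> a \<alpha> m \<or> greedy_expansion \<theta> a (- \<alpha>) m) = - pfloor \<bar>\<beta>\<bar>"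
    by (intro the_equality) blast+
  then show ?thesis using nz unfolding greedy_norm_def by simp
qed

text \<open>The second value is the absolute value of the conjugate of T = \<theta> - 1. For a
  conjugate pair with product 0 the choice is harmless, since then \<beta> = 0.\<close>

definition sign_weight :: "real \<Rightarrow> real \<Rightarrow> real" where
  "sign_weight \<alpha> \<beta> = (if \<alpha> * \<beta> > 0 then 1 else 1 - inverse \<theta>)"

lemma sign_weight_bounds: "0 < sign_weight \<alpha> \<beta>" "1 / 2 \<le> sign_weight \<alpha> \<beta>" "sign_weight \<alpha> \<beta> \<le> 1"
  using theta_gt_2 unfolding sign_weight_def by (auto simp: field_simps)

text \<open>T is positive and its conjugate negative, so multiplying by T turns opposite signs into
  equal ones and scales the conjugate by the weight; then \<open>greedy_norm_eq\<close>
  applies.\<close>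

lemma theta_norm_eq:
  assumes pair: "conj_pair \<alpha> \<beta>" and nz: "\<alpha> \<noteq> 0"
  shows "theta_norm \<theta> a \<alpha> = \<theta> powi (pfloor (sign_weight \<alpha> \<beta> * \<bar>\<beta>\<bar>))"
proof -
  have nz': "\<beta> \<noteq> 0" using conj_pair_zero_iff[OF pair] nz by blast
  have sgn: "sgn \<alpha> = sgn \<beta> \<longleftrightarrow> \<alpha> * \<beta> > 0"
    using nz nz' by (auto simp: sgn_if zero_less_mult_iff split: if_splits)
  show ?thesis
  proof (cases "\<alpha> * \<beta> > 0")
    case True
    then show ?thesis
      using greedy_norm_eq[OF pair True] sgn galois_conj_eq[OF pair]
      unfolding theta_norm_def sign_weight_def by simp
  next
    case False
    then have neg: "\<alpha> * \<beta> < 0" using nz nz' by (simp add: order.strict_iff_order not_less)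
    have inv: "inverse \<theta> < 1" using theta_gt_1 by (simp add: inverse_less_1_iff)
    have pairT: "conj_pair ((\<theta> - 1) * \<alpha>) ((inverse \<theta> - 1) * \<beta>)"
      by (intro conj_pair_mult conj_pair_diff conj_pair_theta conj_pair_1 pair)
    have "(\<theta> - 1) * (inverse \<theta> - 1) < 0"
      using theta_gt_1 inv by (intro mult_pos_neg) auto
    then have "((\<theta> - 1) * (inverse \<theta> - 1)) * (\<alpha> * \<beta>) > 0"
      using neg by (rule mult_neg_neg)
    then have "((\<theta> - 1) * \<alpha>) * ((inverse \<theta> - 1) * \<beta>) > 0" by (simp add: algebra_simps)
    then have "greedy_norm \<theta> a ((\<theta> - 1) * \<alpha>) = \<theta> powi (pfloor \<bar>(inverse \<theta> - 1) * \<beta>\<bar>)"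
      by (rule greedy_norm_eq[OF pairT])
    then show ?thesis
      using False sgn nz galois_conj_eq[OF pair] inv
      unfolding theta_norm_def sign_weight_def by (simp add: abs_mult)
  qed
qed

lemma theta_norm_0 [simp]: "theta_norm \<theta> a 0 = 0"
  by (simp add: theta_norm_def greedy_norm_def)

lemma theta_norm_pos: "conj_pair \<alpha> \<beta> \<Longrightarrow> \<alpha> \<noteq> 0 \<Longrightarrow> theta_norm \<theta> a \<alpha> > 0"
  by (simp add: theta_norm_eq)

lemma theta_norm_minus: "conj_pair \<alpha> \<beta> \<Longrightarrow> theta_norm \<theta> a (- \<alpha>) = theta_norm \<theta> a \<alpha>"
  using theta_norm_eq[of \<alpha> \<beta>] theta_norm_eq[OF conj_pair_minus, of \<alpha> \<beta>]
  by (cases "\<alpha> = 0") (auto simp: sign_weight_def)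

lemma conj_le_theta_norm:
  assumes "conj_pair \<alpha> \<beta>"
  shows "sign_weight \<alpha> \<beta> * \<bar>\<beta>\<bar> \<le> \<theta> * theta_norm \<theta> a \<alpha>"
proof (cases "\<alpha> = 0")
  case True
  then show ?thesis using conj_pair_zero_iff[OF assms] by simp
next
  case False
  then have "\<beta> \<noteq> 0" using conj_pair_zero_iff[OF assms] by blast
  then have "sign_weight \<alpha> \<beta> * \<bar>\<beta>\<bar> > 0" using sign_weight_bounds by simp
  from pfloor_upper[OF this] show ?thesis
    using theta_norm_eq[OF assms False] by (simp add: power_int_add mult.commute)
qed

section \<open>Inequalities for sums\<close>

text \<open>
  The norms are powers of \<open>\<theta>\<close>, so rounding down costs at most one factor \<open>\<theta>\<close>, which strictness of
  \<open>C < \<theta>\<^sup>k\<close> recovers.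
\<close>

lemma theta_norm_add_le:
  assumes f: "conj_pair f f'" and g: "conj_pair g g'"
    and bound: "sign_weight (f + g) (f' + g') * (\<bar>f'\<bar> + \<bar>g'\<bar>) \<le>
      C * (\<theta> * max (theta_norm \<theta> a f) (theta_norm \<theta> a g))"
    and C: "C < \<theta> ^ k"
  shows "theta_norm \<theta> a (f + g) \<le> \<theta> ^ k * max (theta_norm \<theta> a f) (theta_norm \<theta> a g)"
proof -
  let ?N = "max (theta_norm \<theta> a f) (theta_norm \<theta> a g)"
  have nonneg: "theta_norm \<theta> a h \<ge> 0" if "conj_pair h h'" for h h'
    using theta_norm_pos[OF that] by (cases "h = 0") auto
  show ?thesis
  proof (cases "f + g = 0")
    case True
    then show ?thesis using nonneg[OF f] by (simp add: le_max_iff_disj)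
  next
    case False
    \<comment> \<open>The maximum is attained at a nonzero summand, so it is a power of
      \<theta>.\<close>
    then have "f \<noteq> 0 \<and> ?N = theta_norm \<theta> a f \<or> g \<noteq> 0 \<and> ?N = theta_norm \<theta> a g"
      using theta_norm_pos[OF f] theta_norm_pos[OF g]
      by (cases "f = 0"; cases "g = 0") (auto simp: max_def)
    then obtain n where n: "?N = \<theta> powi n"
      using theta_norm_eq[OF f] theta_norm_eq[OF g] by metis
    have pair: "conj_pair (f + g) (f' + g')" using f g by (rule conj_pair_add)
    define x where "x = sign_weight (f + g) (f' + g') * \<bar>f' + g'\<bar>"
    have "f' + g' \<noteq> 0" using conj_pair_zero_iff[OF pair] False by blast
    then have x: "x > 0" unfolding x_def using sign_weight_bounds by simp
    have "x \<le> sign_weight (f + g) (f' + g') * (\<bar>f'\<bar> + \<bar>g'\<bar>)"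
      unfolding x_def using sign_weight_bounds(1)[of "f + g" "f' + g'"] by (intro mult_left_mono) auto
    also note bound
    also have "C * (\<theta> * ?N) < \<theta> ^ k * (\<theta> * ?N)"
      unfolding n using C by (intro mult_strict_right_mono) auto
    also have "\<dots> = \<theta> powi (int k + n + 1)"
      unfolding n by (simp add: power_int_add algebra_simps)
    finally have "\<theta> powi (pfloor x) < \<theta> powi (int k + n + 1)"
      using pfloor_lower[OF x] by linarith
    \<comment> \<open>Integer exponents turn the strict inequality into a gain of one power of
      \<theta>.\<close>
    then have "pfloor x \<le> int k + n"
      using theta_gt_1 power_int_increasing[of "int k + n + 1" "pfloor x" \<theta>] by linarith
    then have "\<theta> powi (pfloor x) \<le> \<theta> powi (int k + n)"
      using theta_gt_1 by (intro power_int_increasing) auto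
    then show ?thesis
      using theta_norm_eq[OF pair False] n by (simp add: x_def power_int_add)
  qed
qed

text \<open>Holds for all sign patterns: weights are at least 1/2, so each conjugate is at most 2 *
  \<theta> times the larger norm. The two add up to the constant 4 <
  \<open>\<theta>\<^sup>2\<close>.\<close>

lemma theta_norm_add_le_square:
  assumes "conj_pair f f'" "conj_pair g g'"
  shows "theta_norm \<theta> a (f + g) \<le> \<theta> ^ 2 * max (theta_norm \<theta> a f) (theta_norm \<theta> a g)"
proof (rule theta_norm_add_le[OF assms, where C = 4])
  let ?N = "max (theta_norm \<theta> a f) (theta_norm \<theta> a g)"
  have half: "\<bar>h'\<bar> \<le> 2 * (sign_weight h h' * \<bar>h'\<bar>)" for h h'
    using mult_right_mono[OF sign_weight_bounds(2), of "\<bar>h'\<bar>" h h'] by simp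
  have "\<theta> * theta_norm \<theta> a f \<le> \<theta> * ?N" "\<theta> * theta_norm \<theta> a g \<le> \<theta> * ?N" by simp_all
  then have "\<bar>f'\<bar> + \<bar>g'\<bar> \<le> 4 * (\<theta> * ?N)"
    using half[of f' f] half[of g' g] conj_le_theta_norm[OF assms(1)] conj_le_theta_norm[OF assms(2)]
    by linarith
  moreover have "sign_weight (f + g) (f' + g') * (\<bar>f'\<bar> + \<bar>g'\<bar>) \<le> \<bar>f'\<bar> + \<bar>g'\<bar>"
    by (rule mult_left_le_one_le) (use sign_weight_bounds in \<open>auto simp: less_imp_le\<close>)
  ultimately show "sign_weight (f + g) (f' + g') * (\<bar>f'\<bar> + \<bar>g'\<bar>) \<le> 4 * (\<theta> * ?N)"
    by (rule order_trans[rotated])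
  show "4 < \<theta> ^ 2"
    using theta_gt_2 power_strict_mono[of 2 \<theta> 2] by simp
qed

text \<open>Here the weights of nonzero summands are 1, so the constant 4 improves to 2 <
  \<theta>.\<close>

lemma theta_norm_add_le_same_sign:
  assumes "conj_pair f f'" "conj_pair g g'" and "f = 0 \<or> f * f' > 0" "g = 0 \<or> g * g' > 0"
  shows "theta_norm \<theta> a (f + g) \<le> \<theta> * max (theta_norm \<theta> a f) (theta_norm \<theta> a g)"
proof -
  let ?N = "max (theta_norm \<theta> a f) (theta_norm \<theta> a g)"
  have same: "\<bar>h'\<bar> \<le> \<theta> * theta_norm \<theta> a h" if "conj_pair h h'" "h = 0 \<or> h * h' > 0" for h h'
    using conj_le_theta_norm[OF that(1)] conj_pair_zero_iff[OF that(1)] that(2)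
    by (auto simp: sign_weight_def)
  have "\<theta> * theta_norm \<theta> a f \<le> \<theta> * ?N" "\<theta> * theta_norm \<theta> a g \<le> \<theta> * ?N" by simp_all
  then have "\<bar>f'\<bar> + \<bar>g'\<bar> \<le> 2 * (\<theta> * ?N)"
    using same[of f f'] same[of g g'] assms by linarith
  moreover have "sign_weight (f + g) (f' + g') * (\<bar>f'\<bar> + \<bar>g'\<bar>) \<le> \<bar>f'\<bar> + \<bar>g'\<bar>"
    by (rule mult_left_le_one_le) (use sign_weight_bounds in \<open>auto simp: less_imp_le\<close>)
  ultimately have "sign_weight (f + g) (f' + g') * (\<bar>f'\<bar> + \<bar>g'\<bar>) \<le> 2 * (\<theta> * ?N)"
    by (rule order_trans[rotated])
  from theta_norm_add_le[OF assms(1,2) this, of 1] show ?thesis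
    using theta_gt_2 by simp
qed

section \<open>The order \<int>[\<theta>] and the infranorm\<close>

lemma int_order_subset_ring_of_integers: "int_order \<theta> \<subseteq> ring_of_integers \<theta>"
proof
  fix \<alpha> assume mem: "\<alpha> \<in> int_order \<theta>"
  then obtain x y :: int where \<alpha>: "\<alpha> = of_int x + of_int y * \<theta>"
    unfolding int_order_def by (auto elim!: Ints_cases)
  \<comment> \<open>The characteristic polynomial: the constant term is the norm of \<alpha>, the
    linear coefficient minus its trace.\<close>
  let ?p = "[:of_int (x\<^sup>2 + a * x * y + y\<^sup>2), - of_int (2 * x + a * y), 1:] :: real poly"
  have "algebraic_int \<alpha>"
  proof (rule algebraic_int.intros[of ?p])
    have "poly ?p \<alpha> = (of_int y)\<^sup>2 * (\<theta>\<^sup>2 - of_int a * \<theta> + 1)"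
      unfolding \<alpha> by (simp add: power2_eq_square algebra_simps)
    then show "poly ?p \<alpha> = 0" using theta_sq by simp
    show "\<forall>i. coeff ?p i \<in> \<int>"
      by (auto simp: coeff_pCons simp del: of_int_add of_int_mult of_int_power split: nat.splits)
  qed simp
  moreover have "\<alpha> \<in> quadratic_field \<theta>"
    using \<alpha> Rats_of_int unfolding quadratic_field_def by blast
  ultimately show "\<alpha> \<in> ring_of_integers \<theta>" unfolding ring_of_integers_def by simp
qed

lemma int_order_iff: "\<alpha> \<in> int_order \<theta> \<longleftrightarrow> (\<exists>\<beta>. conj_pair \<alpha> \<beta>)"
proof
  assume "\<exists>\<beta>. conj_pair \<alpha> \<beta>"
  then show "\<alpha> \<in> int_order \<theta>" using Ints_of_int unfolding conj_pair_def int_order_def by blast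
qed (use conj_pair_galois in blast)

lemma infranorm_int_order: "infranorm_on (int_order \<theta>) (\<theta> ^ 4) (theta_norm \<theta> a)"
proof -
  have nonneg: "theta_norm \<theta> a f \<ge> 0" and zero: "theta_norm \<theta> a f = 0 \<longleftrightarrow> f = 0"
    if "f \<in> int_order \<theta>" for f
    using theta_norm_pos[OF conj_pair_galois[OF that]] by (cases "f = 0"; force)+
  have minus: "theta_norm \<theta> a (- f) = theta_norm \<theta> a f" if "f \<in> int_order \<theta>" for f
    using theta_norm_minus[OF conj_pair_galois[OF that]] .
  have add: "theta_norm \<theta> a (f + g) \<le> \<theta> ^ 4 * max (theta_norm \<theta> a f) (theta_norm \<theta> a g)"
    if "f \<in> int_order \<theta>" "g \<in> int_order \<theta>" for f g
  proof -
    \<comment> \<open>The bound with the square, valid on the whole order, is relaxed to the stated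
      constant.\<close>
    have "\<theta> ^ 2 \<le> \<theta> ^ 4" using theta_gt_1 by (intro power_increasing) auto
    then have "\<theta> ^ 2 * max (theta_norm \<theta> a f) (theta_norm \<theta> a g)
        \<le> \<theta> ^ 4 * max (theta_norm \<theta> a f) (theta_norm \<theta> a g)"
      using nonneg[OF that(1)] by (intro mult_right_mono) auto
    then show ?thesis
      using theta_norm_add_le_square[OF conj_pair_galois conj_pair_galois, OF that] by linarith
  qed
  have closed: "0 \<in> int_order \<theta>" "\<And>f. f \<in> int_order \<theta> \<Longrightarrow> - f \<in> int_order \<theta>"
    "\<And>f g. f \<in> int_order \<theta> \<Longrightarrow> g \<in> int_order \<theta> \<Longrightarrow> f + g \<in> int_order \<theta>"
    unfolding int_order_iff using conj_pair_0 conj_pair_minus conj_pair_add by blast+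
  have diff: "theta_norm \<theta> a (f - g) \<le> \<theta> ^ 4 * max (theta_norm \<theta> a f) (theta_norm \<theta> a g)"
    if "f \<in> int_order \<theta>" "g \<in> int_order \<theta>" for f g
    using add[OF that(1) closed(2)[OF that(2)]] minus[OF that(2)] by simp
  have one: "1 \<le> \<theta> ^ 4" using theta_gt_1 by (intro one_le_power) auto
  show ?thesis
    unfolding infranorm_on_def
    by (intro conjI ballI closed nonneg zero minus add diff one)
qed

end

theorem theorem8:
  fixes \<theta> :: real and a :: int and R :: "real set"
  assumes "a \<ge> 3" and "\<theta> > 1" and "\<theta>\<^sup>2 = of_int a * \<theta> - 1"
    and "R = ring_of_integers \<theta> \<or> R = int_order \<theta>"
    and "R \<subseteq> int_order \<theta>"
  shows "(\<forall>f \<in> same_sign_part \<theta> R. \<forall>g \<in> same_sign_part \<theta> R.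
            theta_norm \<theta> a (f + g) \<le> \<theta> * max (theta_norm \<theta> a f) (theta_norm \<theta> a g)) \<and>
         (\<forall>f \<in> mixed_sign_part \<theta> R. \<forall>g \<in> mixed_sign_part \<theta> R.
            theta_norm \<theta> a (f + g) \<le> \<theta> ^ 2 * max (theta_norm \<theta> a f) (theta_norm \<theta> a g)) \<and>
         (\<forall>f \<in> same_sign_part \<theta> R. \<forall>g \<in> mixed_sign_part \<theta> R.
            theta_norm \<theta> a (f + g) \<le> \<theta> ^ 4 * max (theta_norm \<theta> a f) (theta_norm \<theta> a g)) \<and>
         infranorm_on R (\<theta> ^ 4) (theta_norm \<theta> a)"
proof -
  interpret norm_one_unit \<theta> a by unfold_locales (use assms in auto)
  \<comment> \<open>With the reverse inclusion, either choice of R is \<int>[\<theta>], where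
    \<open>conj_pair\<close> is available.\<close>
  have R: "R = int_order \<theta>" using assms(4,5) int_order_subset_ring_of_integers by auto
  have infra: "infranorm_on R (\<theta> ^ 4) (theta_norm \<theta> a)"
    unfolding R by (rule infranorm_int_order)
  have zero: "0 \<in> R" using infra unfolding infranorm_on_def by blast
  have parts: "f \<in> R" if "f \<in> same_sign_part \<theta> R \<or> f \<in> mixed_sign_part \<theta> R" for f
    using that zero unfolding same_sign_part_def mixed_sign_part_def by auto
  have pair: "conj_pair f (galois_conj \<theta> f)" if "f \<in> R" for f
    using that conj_pair_galois unfolding R by blast
  have same: "f = 0 \<or> f * galois_conj \<theta> f > 0" if "f \<in> same_sign_part \<theta> R" for f
    using that unfolding same_sign_part_def
    by (auto simp: sgn_if zero_less_mult_iff split: if_splits)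
  show ?thesis
  proof (intro conjI ballI)
    fix f g
    assume "f \<in> same_sign_part \<theta> R" "g \<in> same_sign_part \<theta> R"
    then show "theta_norm \<theta> a (f + g) \<le> \<theta> * max (theta_norm \<theta> a f) (theta_norm \<theta> a g)"
      by (intro theta_norm_add_le_same_sign[OF pair pair] same parts) auto
  next
    fix f g
    assume "f \<in> mixed_sign_part \<theta> R" "g \<in> mixed_sign_part \<theta> R"
    then show "theta_norm \<theta> a (f + g) \<le> \<theta> ^ 2 * max (theta_norm \<theta> a f) (theta_norm \<theta> a g)"
      by (intro theta_norm_add_le_square[OF pair pair] parts) auto
  next
    fix f g
    assume "f \<in> same_sign_part \<theta> R" "g \<in> mixed_sign_part \<theta> R"
    then have "f \<in> R" "g \<in> R" using parts by blast+
    with infra show "theta_norm \<theta> a (f + g) \<le> \<theta> ^ 4 * max (theta_norm \<theta> a f) (theta_norm \<theta> a g)"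
      unfolding infranorm_on_def by blast
  qed (rule infra)
qed

end
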